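(* For all $n,k\ge1$, $D(n,k)=\overline{\mathrm{pmx}}(n,k)$, i.e. the cycle-joining sequence $D(n,k)$ equals the reverse of the prefer-max $(n,k)$-De Bruijn sequence.
   Context: $[k]=\{0,\dots,k-1\}$; $\sigma^t$ denotes $t$ repetitions of $\sigma$; $R$ reverses a word. A rotation of $xy$ is $yx$. For words of equal length, $w_1\le_{\mathrm{colex}} w_2$ means $R(w_1)$ is lexicographically $\le R(w_2)$. A key-word is a length-$n$ word colex-maximal among its rotations. Let $c(n,k)$ be the number of key-words in $[k]^n$, listed in increasing colex order $\mathrm{key}_0<\cdots<\mathrm{key}_{c(n,k)-1}$. Cycles: $C_0=(0^n)$. For $m\ge1$ write $\mathrm{key}_m=0^l(\sigma+1)w$; $C_m$ is the sequence of all distinct rotations of $\mathrm{key}_m$, starting with $w0^l(\sigma+1)$, in which each word $\tau w'$ is followed by $w'\tau$, ending with $(\sigma+1)w0^l$. Construction: $D_0=(0^n)$; writing $\mathrm{key}_{m+1}=0^l(\sigma+1)w$, $D_{m+1}$ is obtained from $D_m$ by inserting the sequence $C_{m+1}$ immediately after the word $\sigma w0^l$ of $D_m$. $D(n,k)=D_{c(n,k)-1}$. The prefer-max sequence $\mathrm{pmx}(n,k)=(w_0,\dots,w_{k^n-1})$ is produced by the greedy algorithm starting with $w_0=0^{n-1}(k-1)$ and repeatedly, while possible, choosing as next word $x\tau$, where the current word is $\sigma x$ ($\sigma$ a symbol), with $\tau$ the maximal symbol such that $x\tau$ has not been chosen yet. Its reverse $\overline{\mathrm{pmx}}(n,k)$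 is the sequence $(u_0,\dots,u_{k^n-1})$ with $u_i=R(w_{k^n-1-i})$. *)

theory Defs
  imports Main "HOL-Library.List_Lexorder"
begin

text \<open>
  A word over the alphabet \<open>{0, \<dots>, k - 1}\<close> is a \<^typ>\<open>nat list\<close>.
  On \<^typ>\<open>nat list\<close>, the relations \<open>\<le>\<close> and \<open><\<close> are the
  lexicographic order of \<^theory>\<open>HOL-Library.List_Lexorder\<close>.
\<close>

type_synonym word = "nat list"

definition words :: "nat \<Rightarrow> nat \<Rightarrow> word set" where
  "words n k = {v. length v = n \<and> set v \<subseteq> {..<k}}"

definition rotations :: "word \<Rightarrow> word set" where
  "rotations v = {y @ x |x y. v = x @ y}"

definition colex_le :: "word \<Rightarrow> word \<Rightarrow> bool" where
  "colex_le u v \<longleftrightarrow> rev u \<le> rev v"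

definition key_words :: "nat \<Rightarrow> nat \<Rightarrow> word set" where
  "key_words n k = {v \<in> words n k. \<forall>u \<in> rotations v. colex_le u v}"

definition num_keys :: "nat \<Rightarrow> nat \<Rightarrow> nat" where
  "num_keys n k = card (key_words n k)"

text \<open>
  Listing the key-words in increasing colex order is listing their reversals in increasing
  lexicographic order and reversing every entry.
\<close>

definition key :: "nat \<Rightarrow> nat \<Rightarrow> nat \<Rightarrow> word" where
  "key n k m = map rev (sorted_list_of_set (rev ` key_words n k)) ! m"

text \<open>
  A word \<open>v\<close> containing a nonzero symbol is uniquely \<open>0\<^sup>l (\<sigma>+1) w\<close>, where
  \<open>l = lead_zeros v\<close>, \<open>\<sigma>+1 = lead_symbol v\<close> and \<open>w = lead_rest v\<close>.
\<close>

definition lead_zeros :: "word \<Rightarrow> nat" where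
  "lead_zeros v = length (takeWhile (\<lambda>a. a = 0) v)"

definition lead_symbol :: "word \<Rightarrow> nat" where
  "lead_symbol v = v ! lead_zeros v"

definition lead_rest :: "word \<Rightarrow> word" where
  "lead_rest v = drop (Suc (lead_zeros v)) v"

text \<open>
  The sequence \<open>C\<close> of the key-word \<open>v\<close>. Since \<open>rotate 1 (\<tau> # w') = w' @ [\<tau>]\<close>,
  the distinct rotations are exhausted by the first \<open>card (rotations v)\<close> iterates.
\<close>

definition key_cycle :: "word \<Rightarrow> word list" where
  "key_cycle v =
     map (\<lambda>i. rotate i (lead_rest v @ replicate (lead_zeros v) 0 @ [lead_symbol v]))
         [0..<card (rotations v)]"

text \<open>The word \<open>\<sigma> w 0\<^sup>l\<close> after which the cycle of \<open>v = 0\<^sup>l (\<sigma>+1) w\<close> is inserted.\<close>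

definition join_word :: "word \<Rightarrow> word" where
  "join_word v = (lead_symbol v - 1) # lead_rest v @ replicate (lead_zeros v) 0"

primrec insert_after :: "'a \<Rightarrow> 'a list \<Rightarrow> 'a list \<Rightarrow> 'a list" where
  "insert_after u xs [] = []"
| "insert_after u xs (y # ys) = (if y = u then y # xs @ ys else y # insert_after u xs ys)"

primrec join_upto :: "nat \<Rightarrow> nat \<Rightarrow> nat \<Rightarrow> word list" where
  "join_upto n k 0 = [replicate n 0]"
| "join_upto n k (Suc m) =
     insert_after (join_word (key n k (Suc m))) (key_cycle (key n k (Suc m))) (join_upto n k m)"

definition cycle_joining :: "nat \<Rightarrow> nat \<Rightarrow> word list" where
  "cycle_joining n k = join_upto n k (num_keys n k - 1)"

definition next_symbols :: "nat \<Rightarrow> word list \<Rightarrow> nat set" where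
  "next_symbols k h = {\<tau>. \<tau> < k \<and> tl (last h) @ [\<tau>] \<notin> set h}"

text \<open>\<open>h\<close> is the list of the words chosen so far, in the order of their choice.\<close>

function greedy_max :: "nat \<Rightarrow> word list \<Rightarrow> word list" where
  "greedy_max k h =
     (if next_symbols k h = {} then h
      else greedy_max k (h @ [tl (last h) @ [Max (next_symbols k h)]]))"
  by pat_completeness auto

termination
proof (relation "measure (\<lambda>(k, h).
    card ({v. set v \<subseteq> {..<k} \<union> set (last h) \<and> length v = max 1 (length (last h))} - set h))")
  show "wf (measure (\<lambda>(k, h).
    card ({v. set v \<subseteq> {..<k} \<union> set (last h) \<and> length v = max 1 (length (last h))} - set h)))"
    by simp
next
  fix k :: nat and h :: "word list"
  assume ne: "next_symbols k h \<noteq> {}"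
  let ?U = "\<lambda>h. {v. set v \<subseteq> {..<k} \<union> set (last h) \<and> length v = max 1 (length (last h))}"
  let ?v = "tl (last h) @ [Max (next_symbols k h)]"
  let ?h = "h @ [?v]"
  have "finite (next_symbols k h)"
    by (simp add: next_symbols_def)
  then have "Max (next_symbols k h) \<in> next_symbols k h"
    using ne by (rule Max_in)
  then have lt: "Max (next_symbols k h) < k" and new: "?v \<notin> set h"
    by (auto simp: next_symbols_def)
  have len: "length ?v = max 1 (length (last h))"
    by simp
  have tl: "set (tl (last h)) \<subseteq> set (last h)"
    by (cases "last h") auto
  then have inU: "?v \<in> ?U h"
    using lt len by auto
  have sub: "?U ?h \<subseteq> ?U h"
    using tl lt by auto
  have "?U ?h - set ?h \<subset> ?U h - set h"
  proof (rule psubsetI)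
    show "?U ?h - set ?h \<subseteq> ?U h - set h"
      by (rule Diff_mono[OF sub]) auto
    have "?v \<in> ?U h - set h" "?v \<notin> ?U ?h - set ?h"
      using inU new by simp_all
    then show "?U ?h - set ?h \<noteq> ?U h - set h"
      by blast
  qed
  moreover have "finite (?U h - set h)"
    by (intro finite_Diff finite_lists_length_eq) auto
  ultimately have "card (?U ?h - set ?h) < card (?U h - set h)"
    by (rule psubset_card_mono[rotated])
  then show "((k, ?h), (k, h)) \<in> measure (\<lambda>(k, h).
    card ({v. set v \<subseteq> {..<k} \<union> set (last h) \<and> length v = max 1 (length (last h))} - set h))"
    by simp
qed

declare greedy_max.simps [simp del]

definition prefer_max :: "nat \<Rightarrow> nat \<Rightarrow> word list" where
  "prefer_max n k = greedy_max k [replicate (n - 1) 0 @ [k - 1]]"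

text \<open>
  The order of the words is reversed and so is each single word, so the \<open>i\<close>-th entry is the
  reversal of the \<open>i\<close>-th last word of \<^term>\<open>prefer_max n k\<close>.
\<close>

definition prefer_max_rev :: "nat \<Rightarrow> nat \<Rightarrow> word list" where
  "prefer_max_rev n k = map rev (rev (prefer_max n k))"

end

theory Submission
  imports Defs
begin

text \<open>
  A list of all words whose consecutive entries overlap is the reverse of the prefer-max sequence
  as soon as it ends with \<open>(k-1) 0\<^sup>n\<^sup>-\<^sup>1\<close> and, for every \<open>x\<close>, the word \<open>\<sigma> x\<close> occurs before
  \<open>(\<sigma>+1) x\<close>. Both properties follow from one observation: with \<open>v = key\<^sub>m\<close>, \<open>m \<ge> 1\<close>, the sequence
  \<open>D\<^sub>m\<close> ends with the \<open>n\<close> words obtained from \<open>v\<close> by shifting in zeros on the right. The colex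
  predecessor of \<open>0\<^sup>l (\<sigma>+1) w\<close> ends with \<open>\<sigma> w\<close>, so the new cycle is inserted into this final
  segment, and only words \<open>s 0 \<dots> 0\<close> with \<open>s\<close> a suffix of \<open>w\<close> remain after it. If \<open>(\<tau>+1) y\<close> is in
  the new cycle, then the key-word of \<open>\<tau> y\<close> is smaller, so \<open>\<tau> y\<close> is already present; it is not one
  of the remaining words, for incrementing the first letter of such an \<open>s\<close> and rotating it to the
  end would give a rotation exceeding the key-word.
\<close>

section \<open>Lexicographic order\<close>

lemma append_less_append:
  fixes a b :: "'a::linorder"
  assumes "a < b"
  shows "xs @ a # ys < xs @ b # zs"
  using assms by (induction xs) auto

lemma not_less_replicate_0:
  fixes ys :: "nat list"
  assumes "length ys = l"
  shows "\<not> ys < replicate l 0"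
  using assms by (induction l arbitrary: ys) (auto simp: length_Suc_conv)

text \<open>Both bounds start with \<open>xs\<close>, which forces this prefix on \<open>u\<close>.
  The next letter is \<open>a\<close> or \<open>Suc a\<close>, and \<open>Suc a\<close> would leave
  a tail below the zero word. Applied to reversed words, this reads off the end of a colex
  predecessor.\<close>

lemma between_append_Suc:
  fixes u :: "nat list"
  assumes "xs @ a # replicate l 0 \<le> u" "u < xs @ Suc a # replicate l 0"
    and "length u = length xs + Suc l"
  obtains ys where "u = xs @ a # ys" "length ys = l"
proof -
  have "\<exists>ys. u = xs @ a # ys \<and> length ys = l"
    using assms
  proof (induction xs arbitrary: u)
    case Nil
    then obtain c ys where u: "u = c # ys" "length ys = l"
      by (auto simp: length_Suc_conv)
    with Nil show ?case
      using not_less_replicate_0[of ys l] by (auto simp: less_Suc_eq)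
  next
    case (Cons x xs)
    then obtain c u' where u: "u = c # u'" "length u' = length xs + Suc l"
      by (auto simp: length_Suc_conv)
    with Cons.prems have "c = x"
      by auto
    with u Cons show ?case
      by auto
  qed
  then show thesis
    using that by blast
qed

section \<open>Rotations\<close>

lemma inj_rotate: "inj (rotate i)"
  unfolding rotate_def by (rule inj_fn[OF inj_rotate1])

lemma rotate_replicate: "rotate i (replicate n a) = replicate n a"
  by (induction i) simp_all

lemma rotations_conv_rotate: "rotations v = range (\<lambda>i. rotate i v)"
proof (intro equalityI subsetI)
  fix u
  assume "u \<in> rotations v"
  then obtain x y where "v = x @ y" "u = y @ x"
    by (auto simp: rotations_def)
  then have "u = rotate (length x) v"
    by (simp add: rotate_append)
  then show "u \<in> range (\<lambda>i. rotate i v)"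
    by simp
next
  fix u
  assume "u \<in> range (\<lambda>i. rotate i v)"
  then obtain i where "u = rotate i v"
    by auto
  then have "u = drop (i mod length v) v @ take (i mod length v) v"
    by (simp add: rotate_drop_take)
  then show "u \<in> rotations v"
    unfolding rotations_def by (metis (mono_tags, lifting) append_take_drop_id mem_Collect_eq)
qed

lemma append_swap_in_rotations: "y @ x \<in> rotations (x @ y)"
  by (auto simp: rotations_def)

lemma rotations_refl: "v \<in> rotations v"
  using append_swap_in_rotations[of v "[]"] by simp

lemma rotations_eq:
  assumes "u \<in> rotations v"
  shows "rotations u = rotations v"
proof -
  obtain x y where xy: "v = x @ y" "u = y @ x"
    using assms by (auto simp: rotations_def)
  have "u = rotate (length x) v" "v = rotate (length y) u"
    by (simp_all add: xy rotate_append)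
  then show ?thesis
    unfolding rotations_conv_rotate by (metis (no_types, lifting) image_subset_iff rangeI rotate_rotate subset_antisym)
qed

lemma rotations_sym: "u \<in> rotations v \<Longrightarrow> v \<in> rotations u"
  using rotations_eq rotations_refl by blast

lemma length_rotations: "u \<in> rotations v \<Longrightarrow> length u = length v"
  by (auto simp: rotations_def)

lemma set_rotations: "u \<in> rotations v \<Longrightarrow> set u = set v"
  by (auto simp: rotations_def)

lemma rotations_subset_words: "v \<in> words n k \<Longrightarrow> rotations v \<subseteq> words n k"
  by (auto simp: words_def dest: length_rotations set_rotations)

lemma finite_rotations: "finite (rotations v)"
proof -
  have "rotations v \<subseteq> {u. set u \<subseteq> set v \<and> length u = length v}"
    by (auto dest: length_rotations set_rotations)
  then show ?thesis
    by (rule finite_subset) (simp add: finite_lists_length_eq)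
qed

lemma card_rotations_pos: "0 < card (rotations v)"
  using rotations_refl finite_rotations card_gt_0_iff by blast

section \<open>Periods of iterated rotation\<close>

lemma rotate_mod_period:
  assumes "rotate d v = v"
  shows "rotate i v = rotate (i mod d) v"
proof -
  have "rotate (q * d) v = v" for q
    by (induction q) (simp_all add: assms add.commute[of d] flip: rotate_rotate)
  from this[of "i div d"] show ?thesis
    by (metis mod_mult_div_eq add.commute mult.commute rotate_rotate)
qed

text \<open>Equal iterates \<open>i < j\<close> cancel to a period \<open>j - i\<close>. Then the
  first \<open>j - i\<close> iterates would exhaust the rotations, but they are too few.\<close>

lemma inj_on_rotate: "inj_on (\<lambda>i. rotate i v) {..<card (rotations v)}"
proof (rule linorder_inj_onI')
  fix i j
  assume ij: "i \<in> {..<card (rotations v)}" "j \<in> {..<card (rotations v)}" "i < j"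
  show "rotate i v \<noteq> rotate j v"
  proof
    assume "rotate i v = rotate j v"
    then have "rotate i (rotate (j - i) v) = rotate i v"
      using \<open>i < j\<close> by (simp add: rotate_rotate)
    then have per: "rotate (j - i) v = v"
      using inj_rotate by (metis injD)
    have "rotations v \<subseteq> (\<lambda>i. rotate i v) ` {..<j - i}"
    proof
      fix u
      assume "u \<in> rotations v"
      then obtain t where "u = rotate t v"
        by (auto simp: rotations_conv_rotate)
      then have "u = rotate (t mod (j - i)) v"
        using rotate_mod_period[OF per] by simp
      then show "u \<in> (\<lambda>i. rotate i v) ` {..<j - i}"
        using \<open>i < j\<close> by auto
    qed
    then have "card (rotations v) \<le> j - i"
      using surj_card_le[of "{..<j - i}"] by simp
    with ij show False
      by auto
  qed
qed

lemma rotations_eq_image: "(\<lambda>i. rotate i v) ` {..<card (rotations v)} = rotations v"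
  by (intro card_subset_eq finite_rotations)
    (auto simp: rotations_conv_rotate card_image inj_on_rotate[unfolded rotations_conv_rotate])

text \<open>This iterate equals an iterate \<open>i\<close> below it. Were \<open>i\<close>
  positive, undoing one rotation on both sides would give two equal iterates in the range where they
  are distinct.\<close>

lemma rotate_card_rotations: "rotate (card (rotations v)) v = v"
proof -
  let ?c = "card (rotations v)"
  have "rotate ?c v \<in> rotations v"
    by (auto simp: rotations_conv_rotate)
  then obtain i where i: "i < ?c" "rotate ?c v = rotate i v"
    using rotations_eq_image[of v] by (metis (no_types, lifting) imageE lessThan_iff)
  have "i = 0"
  proof (rule ccontr)
    assume "i \<noteq> 0"
    then obtain i' c' where S: "i = Suc i'" "?c = Suc c'"
      using i by (metis gr0_conv_Suc not_gr_zero less_nat_zero_code)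
    then have "rotate c' v = rotate i' v"
      using i inj_rotate1 by (metis injD rotate_Suc)
    then have "c' = i'"
      using inj_on_rotate[of v] S i by (auto simp: inj_on_def)
    with S i show False
      by simp
  qed
  with i show ?thesis
    by simp
qed

section \<open>Key-words\<close>

lemma finite_words: "finite (words n k)"
  unfolding words_def using finite_lists_length_eq[of "{..<k}" n] by (simp add: conj_commute)

lemma key_words_subset: "key_words n k \<subseteq> words n k"
  by (auto simp: key_words_def)

lemma finite_key_words: "finite (key_words n k)"
  using finite_subset[OF key_words_subset finite_words] .

lemma key_words_rotation_le: "v \<in> key_words n k \<Longrightarrow> u \<in> rotations v \<Longrightarrow> rev u \<le> rev v"
  by (auto simp: key_words_def colex_le_def)

text \<open>Both are colex-maximal in the same rotation class, so antisymmetry identifies them. This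
  makes cycles of different key-words disjoint.\<close>

lemma key_words_rotations_eq:
  assumes "u \<in> key_words n k" "v \<in> key_words n k" "x \<in> rotations u" "x \<in> rotations v"
  shows "u = v"
proof -
  have "rotations u = rotations v"
    using assms rotations_eq by metis
  then have "rev u \<le> rev v" "rev v \<le> rev u"
    using assms key_words_rotation_le rotations_refl by metis+
  then show ?thesis
    by simp
qed

lemma ex_key_word_rotation:
  assumes "u \<in> words n k"
  obtains v where "v \<in> key_words n k" "v \<in> rotations u" "u \<in> rotations v"
proof -
  let ?M = "Max (rev ` rotations u)"
  have fin: "finite (rev ` rotations u)" and ne: "rev ` rotations u \<noteq> {}"
    using finite_rotations rotations_refl by auto
  obtain v where v: "v \<in> rotations u" "rev v = ?M"
    using Max_in[OF fin ne] by (metis imageE)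
  have "rev x \<le> rev v" if "x \<in> rotations v" for x
    using that v fin rotations_eq[OF v(1)] by simp
  moreover have "v \<in> words n k"
    using assms v rotations_subset_words by blast
  ultimately show thesis
    using that[of v] v rotations_sym by (auto simp: key_words_def colex_le_def)
qed

text \<open>Cut \<open>Suc a # y\<close> where \<open>u\<close> cuts \<open>a # y\<close>. The
  result is a rotation of \<open>v\<close> that differs from \<open>u\<close> in one larger letter
  only, and \<open>v\<close> is at least as large.\<close>

lemma key_words_decrement_less:
  assumes "v \<in> key_words n k" "Suc a # y \<in> rotations v" "u \<in> rotations (a # y)"
  shows "rev u < rev v"
proof -
  obtain x z where xz: "a # y = x @ z" "u = z @ x"
    using assms by (auto simp: rotations_def)
  obtain b where b: "b \<in> rotations (Suc a # y)" "rev u < rev b"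
  proof (cases x)
    case Nil
    then show thesis
      using xz that[of "Suc a # y"] rotations_refl append_less_append[of a "Suc a" "rev y" "[]" "[]"] by auto
  next
    case (Cons c x')
    then have y: "y = x' @ z" "u = z @ a # x'"
      using xz by auto
    show thesis
    proof (rule that)
      show "z @ Suc a # x' \<in> rotations (Suc a # y)"
        using append_swap_in_rotations[of z "Suc a # x'"] y by simp
      show "rev u < rev (z @ Suc a # x')"
        using append_less_append[of a "Suc a" "rev x'"] y by simp
    qed
  qed
  have "rev b \<le> rev v"
    using key_words_rotation_le assms b rotations_eq by metis
  with b show ?thesis
    by order
qed

text \<open>Turning the zeros to the front gives a word that agrees with the key-word on
  \<open>s\<close> and is larger in the letter before it, against maximality.\<close>

lemma key_words_suffix_increment:
  assumes "q @ a # s \<in> key_words n k"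
  shows "Suc a # s @ replicate (length q) 0 \<notin> rotations (q @ a # s)"
proof
  let ?r = "replicate (length q) 0"
  assume "Suc a # s @ ?r \<in> rotations (q @ a # s)"
  then have "?r @ Suc a # s \<in> rotations (q @ a # s)"
    using append_swap_in_rotations[of ?r "Suc a # s"] rotations_eq by simp
  then have "rev (?r @ Suc a # s) \<le> rev (q @ a # s)"
    using key_words_rotation_le[OF assms] by blast
  moreover have "rev (q @ a # s) < rev (?r @ Suc a # s)"
    using append_less_append[of a "Suc a" "rev s"] by simp
  ultimately show False
    by order
qed

text \<open>A rotation ending in \<open>Suc a\<close> beats every word ending in
  \<open>0\<close>.\<close>

lemma key_words_no_trailing_0:
  assumes "x @ Suc a # y @ replicate j 0 \<in> key_words n k"
  shows "j = 0"
proof (rule ccontr)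
  assume "j \<noteq> 0"
  then obtain i where j: "j = Suc i"
    by (cases j) auto
  have "(y @ replicate j 0) @ x @ [Suc a] \<in> rotations (x @ Suc a # y @ replicate j 0)"
    using append_swap_in_rotations[of "y @ replicate j 0" "x @ [Suc a]"] by simp
  from key_words_rotation_le[OF assms this] show False
    by (simp add: j replicate_app_Cons_same)
qed

section \<open>Enumeration of the key-words in colex order\<close>

lemma key_props:
  fixes n k m :: nat
  defines "S \<equiv> sorted_list_of_set (rev ` key_words n k)"
  shows "length S = num_keys n k"
    and "m < num_keys n k \<Longrightarrow> rev (key n k m) = S ! m"
proof -
  show "length S = num_keys n k"
    by (simp add: S_def num_keys_def card_image)
  then show "m < num_keys n k \<Longrightarrow> rev (key n k m) = S ! m"
    by (simp add: key_def S_def)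
qed

lemma key_in_key_words: "m < num_keys n k \<Longrightarrow> key n k m \<in> key_words n k"
  using key_props[where n = n and k = k] finite_key_words[of n k]
  by (metis (no_types, lifting) finite_imageI imageE nth_mem rev_rev_ident set_sorted_list_of_set)

lemma key_less_key:
  assumes "i < j" "j < num_keys n k"
  shows "rev (key n k i) < rev (key n k j)"
  using assms key_props(1)[of n k] strict_sorted_list_of_set[of "rev ` key_words n k"]
  by (simp add: key_props(2) sorted_wrt_iff_nth_less)

lemma ex_key:
  assumes "u \<in> key_words n k"
  obtains m where "m < num_keys n k" "u = key n k m"
proof -
  have "rev u \<in> set (sorted_list_of_set (rev ` key_words n k))"
    using assms finite_key_words by simp
  then show thesis
    using that key_props[where n = n and k = k] by (metis in_set_conv_nth rev_rev_ident)
qed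

lemma ex_key_less:
  assumes "u \<in> key_words n k" "rev u < rev (key n k m)" "m < num_keys n k"
  obtains i where "i < m" "u = key n k i"
proof -
  obtain i where i: "i < num_keys n k" "u = key n k i"
    using ex_key[OF assms(1)] .
  have "i < m"
    using i assms key_less_key[of m i n k] by (metis nat_neq_iff order_less_asym order_less_irrefl)
  with i show thesis
    using that by blast
qed

lemma constant_key_word: "a < k \<Longrightarrow> replicate n a \<in> key_words n k"
proof -
  assume "a < k"
  then show ?thesis
    by (auto simp: key_words_def words_def rotations_conv_rotate rotate_replicate colex_le_def)
qed

lemma num_keys_pos: "1 \<le> k \<Longrightarrow> 0 < num_keys n k"
  using constant_key_word[of 0 k n] finite_key_words[of n k] by (auto simp: num_keys_def card_gt_0_iff)

lemma key_0:
  assumes "1 \<le> k"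
  shows "key n k 0 = replicate n 0"
proof -
  obtain m where m: "m < num_keys n k" "replicate n 0 = key n k m"
    using ex_key[OF constant_key_word[of 0 k n]] assms by auto
  have "m = 0"
  proof (rule ccontr)
    assume "m \<noteq> 0"
    then have "rev (key n k 0) < replicate n 0"
      using key_less_key[of 0 m n k] m by (metis not_gr_zero rev_replicate)
    moreover have "length (key n k 0) = n"
      using key_in_key_words[of 0 n k] m key_words_subset by (fastforce simp: words_def)
    ultimately show False
      using not_less_replicate_0[of "rev (key n k 0)" n] by simp
  qed
  with m show ?thesis
    by simp
qed

lemma key_nonzero:
  assumes "1 \<le> k" "Suc m < num_keys n k"
  shows "key n k (Suc m) \<noteq> replicate n 0"
  using key_less_key[of 0 "Suc m" n k] key_0 assms by fastforce

lemma last_key: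
  assumes "1 \<le> k"
  shows "key n k (num_keys n k - 1) = replicate n (k - 1)"
proof -
  obtain m where m: "m < num_keys n k" "replicate n (k - 1) = key n k m"
    using ex_key[OF constant_key_word[of "k - 1" k n]] assms by auto
  have le: "u \<le> replicate n (k - 1)" if "length u = n" "set u \<subseteq> {..<k}" for u n
    using that
  proof (induction n arbitrary: u)
    case 0
    then show ?case by simp
  next
    case (Suc n)
    then obtain a u' where u: "u = a # u'" "length u' = n"
      by (auto simp: length_Suc_conv)
    with Suc show ?case
      by auto
  qed
  have "m = num_keys n k - 1"
  proof (rule ccontr)
    assume "m \<noteq> num_keys n k - 1"
    then have "replicate n (k - 1) < rev (key n k (num_keys n k - 1))"
      using key_less_key[of m "num_keys n k - 1" n k] m by (metis Suc_pred' diff_less less_Suc_eq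
          less_nat_zero_code not_gr_zero rev_replicate zero_less_one)
    moreover have "key n k (num_keys n k - 1) \<in> words n k"
      using key_in_key_words[of "num_keys n k - 1" n k] m key_words_subset by fastforce
    ultimately show False
      using le[of "rev (key n k (num_keys n k - 1))" n] by (auto simp: words_def)
  qed
  with m show ?thesis
    by simp
qed

section \<open>The cycle of a key-word\<close>

lemma lead_simps:
  assumes "v = replicate l 0 @ Suc a # w"
  shows "lead_zeros v = l" "lead_symbol v = Suc a" "lead_rest v = w"
proof -
  show l: "lead_zeros v = l"
    by (simp add: assms lead_zeros_def takeWhile_append)
  show "lead_symbol v = Suc a" "lead_rest v = w"
    unfolding lead_symbol_def lead_rest_def l by (simp_all add: assms nth_append)
qed

lemma ex_lead_form:
  assumes "v \<noteq> replicate (length v) 0"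
  obtains l a w where "v = replicate l 0 @ Suc a # w"
proof -
  have "\<exists>l a w. v = replicate l 0 @ Suc a # w"
    using assms
  proof (induction v)
    case Nil
    then show ?case by simp
  next
    case (Cons c v)
    show ?case
    proof (cases c)
      case 0
      with Cons obtain l a w where "v = replicate l 0 @ Suc a # w"
        by auto
      with 0 have "c # v = replicate (Suc l) 0 @ Suc a # w"
        by simp
      then show ?thesis by blast
    next
      case (Suc a)
      then have "c # v = replicate 0 0 @ Suc a # v"
        by simp
      then show ?thesis by blast
    qed
  qed
  with that show thesis
    by blast
qed

lemma key_cycle_conv:
  assumes v: "v = replicate l 0 @ Suc a # w"
  shows "key_cycle v = map (\<lambda>i. rotate i (rotate (Suc l) v)) [0..<card (rotations v)]"
proof -
  have "rotate (Suc l) v = w @ replicate l 0 @ [Suc a]"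
    using rotate_append[of "replicate l 0 @ [Suc a]" w] by (simp add: v del: rotate_Suc)
  then show ?thesis
    by (simp add: key_cycle_def lead_simps[OF v])
qed

lemma rotations_rotate: "rotations (rotate i v) = rotations v"
  using rotations_eq[of "rotate i v" v] by (auto simp: rotations_conv_rotate[of v])

lemma set_key_cycle:
  assumes v: "v = replicate l 0 @ Suc a # w"
  shows "set (key_cycle v) = rotations v"
  using rotations_eq_image[of "rotate (Suc l) v"]
  by (simp add: key_cycle_conv[OF v] rotations_rotate atLeast0LessThan del: rotate_Suc)

lemma distinct_key_cycle:
  assumes v: "v = replicate l 0 @ Suc a # w"
  shows "distinct (key_cycle v)"
  using inj_on_rotate[of "rotate (Suc l) v"]
  by (simp add: key_cycle_conv[OF v] rotations_rotate distinct_map atLeast0LessThan del: rotate_Suc)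

lemma successively_rotate:
  "successively (\<lambda>u v. tl u = butlast v) (map (\<lambda>i. rotate i u) [0..<c])"
proof -
  have "tl x = butlast (rotate1 x)" for x :: "'a list"
    by (cases x) auto
  \<comment> \<open>One extra iterate makes the list nonempty with known last entry
    \<open>rotate c u\<close>, as the induction step needs; it is dropped afterwards.\<close>
  then have "successively (\<lambda>u v. tl u = butlast v) (map (\<lambda>i. rotate i u) [0..<Suc c])"
    by (induction c) (auto simp: successively_append_iff)
  then show ?thesis
    by (simp add: successively_append_iff)
qed

text \<open>The cycle ends with the rotations of \<open>v\<close> by \<open>0\<close> to
  \<open>l\<close>. These only carry leading zeros to the end, so they agree with shifts that fill
  in zeros.\<close>

lemma key_cycle_suffix:
  assumes v: "v = replicate l 0 @ Suc a # w"
  obtains E where "key_cycle v = E @ map (\<lambda>i. drop i v @ replicate i 0) [0..<Suc l]"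
proof -
  let ?c = "card (rotations v)"
  \<comment> \<open>Otherwise rotating by the positive number \<open>?c\<close> would fix
    \<open>v\<close> and yet strip \<open>?c\<close> of its leading zeros.\<close>
  have "l < ?c"
  proof (rule ccontr)
    assume "\<not> l < ?c"
    then have le: "?c \<le> l"
      by simp
    then have "v = replicate ?c 0 @ replicate (l - ?c) 0 @ Suc a # w"
      by (simp add: v flip: replicate_add)
    then have "rotate ?c v = replicate (l - ?c) 0 @ Suc a # w @ replicate ?c 0"
      using rotate_append[of "replicate ?c 0"] by (metis append_assoc append_Cons length_replicate)
    then have "lead_zeros v = l - ?c"
      using lead_simps(1) rotate_card_rotations by metis
    with le show False
      using lead_simps(1)[OF v] card_rotations_pos[of v] by simp
  qed
  \<comment> \<open>At index \<open>?d + i\<close> the total rotation of \<open>v\<close> is by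
    \<open>?c + i\<close>, which acts like \<open>i\<close>.\<close>
  let ?d = "?c - Suc l"
  have "map (\<lambda>i. rotate i (rotate (Suc l) v)) [?d..<?c]
    = map (\<lambda>i. drop i v @ replicate i 0) [0..<Suc l]"
  proof (rule nth_equalityI)
    show "length (map (\<lambda>i. rotate i (rotate (Suc l) v)) [?d..<?c])
      = length (map (\<lambda>i. drop i v @ replicate i 0) [0..<Suc l])"
      using \<open>l < ?c\<close> by simp
  next
    fix i
    assume "i < length (map (\<lambda>i. rotate i (rotate (Suc l) v)) [?d..<?c])"
    then have i: "i < Suc l"
      using \<open>l < ?c\<close> by simp
    have "rotate (?d + i) (rotate (Suc l) v) = rotate i (rotate ?c v)"
      using \<open>l < ?c\<close> by (simp add: rotate_rotate add.commute del: rotate_Suc)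
    also have "\<dots> = rotate i v"
      by (simp add: rotate_card_rotations)
    also have "\<dots> = drop i v @ take i v"
      using i by (simp add: rotate_drop_take v)
    also have "take i v = replicate i 0"
      using i by (simp add: v)
    finally show "map (\<lambda>i. rotate i (rotate (Suc l) v)) [?d..<?c] ! i
      = map (\<lambda>i. drop i v @ replicate i 0) [0..<Suc l] ! i"
      using i \<open>l < ?c\<close> by (simp del: rotate_Suc upt_Suc)
  qed
  moreover have "[0..<?c] = [0..<?d] @ [?d..<?c]"
    using upt_add_eq_append[of 0 ?d "Suc l"] \<open>l < ?c\<close> by simp
  ultimately have "key_cycle v = map (\<lambda>i. rotate i (rotate (Suc l) v)) [0..<?d]
      @ map (\<lambda>i. drop i v @ replicate i 0) [0..<Suc l]"
    by (simp add: key_cycle_conv[OF v] del: rotate_Suc upt_Suc)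
  then show thesis
    by (rule that)
qed

section \<open>The invariant of the joined sequence\<close>

lemma insert_after_append:
  "u \<notin> set ys \<Longrightarrow> insert_after u xs (ys @ u # zs) = ys @ u # xs @ zs"
  by (induction ys) auto

text \<open>The zero word is singled out because all its shifts coincide, whereas the joined
  sequence contains it only once.\<close>

definition zero_shifts :: "nat \<Rightarrow> word \<Rightarrow> word list" where
  "zero_shifts n v = (if v = replicate n 0 then [v] else map (\<lambda>i. drop i v @ replicate i 0) [0..<n])"

text \<open>Reversed form of the greedy preference for large symbols. It is stated for neighbouring
  letters, since this is what an insertion provides directly.\<close>

definition preceded :: "word list \<Rightarrow> bool" where
  "preceded xs \<longleftrightarrow> (\<forall>ys a x zs. xs = ys @ (Suc a # x) # zs \<longrightarrow> a # x \<in> set ys)"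

text \<open>The last clause carries the induction: it tells where the next cycle is inserted and
  which words stay behind it. It also yields the last word of the full sequence.\<close>

definition joined :: "nat \<Rightarrow> nat \<Rightarrow> nat \<Rightarrow> word list \<Rightarrow> bool" where
  "joined n k m xs \<longleftrightarrow>
     distinct xs \<and> set xs = (\<Union>i\<le>m. rotations (key n k i)) \<and>
     successively (\<lambda>u v. tl u = butlast v) xs \<and> preceded xs \<and>
     (\<exists>ys. xs = ys @ zero_shifts n (key n k m))"

lemma append_eq_append_Cons_cases:
  assumes "xs @ ys = us @ v # vs"
  obtains (left) ws where "xs = us @ v # ws" | (right) ws where "us = xs @ ws" "ys = ws @ v # vs"
proof -
  have "(\<exists>ws. xs = us @ v # ws) \<or> (\<exists>ws. us = xs @ ws \<and> ys = ws @ v # vs)"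
    using assms
  proof (induction xs arbitrary: us)
    case (Cons x xs)
    then show ?case
      by (cases us) auto
  qed simp
  with left right show thesis
    by blast
qed

text \<open>Words of \<open>A\<close> and \<open>B\<close> keep their relative order, and those of
  \<open>C\<close> find their smaller neighbours in \<open>A\<close>, which lies before
  them.\<close>

lemma preceded_insert:
  assumes "preceded (A @ B)"
    and "\<And>a x. Suc a # x \<in> set C \<Longrightarrow> a # x \<in> set A"
  shows "preceded (A @ C @ B)"
  unfolding preceded_def
proof (intro allI impI)
  fix ys a x zs
  assume eq: "A @ C @ B = ys @ (Suc a # x) # zs"
  let ?u = "Suc a # x"
  have pre: "a # x \<in> set ys'" if "A @ B = ys' @ ?u # zs'" for ys' zs'
    using assms(1) that by (auto simp: preceded_def)
  from eq show "a # x \<in> set ys"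
  proof (cases rule: append_eq_append_Cons_cases)
    case (left us)
    then show ?thesis
      using pre[of ys "us @ B"] by simp
  next
    case outer: (right us)
    from outer(2) show ?thesis
    proof (cases rule: append_eq_append_Cons_cases)
      case (left vs)
      then show ?thesis
        using assms(2)[of a x] outer by simp
    next
      case (right vs)
      then show ?thesis
        using pre[of "A @ vs" zs] outer by auto
    qed
  qed
qed

lemma joined_0:
  assumes "1 \<le> k"
  shows "joined n k 0 (join_upto n k 0)"
proof -
  have "replicate n 0 \<noteq> Suc a # x" for a x
    by (cases n) auto
  moreover have "rotations (replicate n (0::nat)) = {replicate n 0}"
    by (auto simp: rotations_conv_rotate rotate_replicate)
  ultimately show ?thesis
    by (auto simp: joined_def preceded_def zero_shifts_def key_0[OF assms] Cons_eq_append_conv)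
qed

text \<open>The words \<open>0\<^sup>l \<sigma> w\<close> and \<open>0\<^sup>l (\<sigma>+1) w\<close> enclose the colex predecessor of the key-word
  \<open>0\<^sup>l (\<sigma>+1) w\<close>, because the key-word of the former lies below the latter.\<close>

lemma previous_key:
  assumes m: "Suc m < num_keys n k" and v: "key n k (Suc m) = replicate l 0 @ Suc a # w"
  obtains z where "key n k m = z @ a # w" "length z = l"
proof -
  let ?v = "key n k (Suc m)" and ?p = "replicate l 0 @ a # w"
  have vK: "?v \<in> key_words n k"
    using key_in_key_words[OF m] .
  then have len: "length ?v = n" and "?v \<in> words n k"
    by (auto simp: key_words_def words_def)
  then have "?p \<in> words n k"
    by (auto simp: v words_def)
  then obtain u where u: "u \<in> key_words n k" "u \<in> rotations ?p" "?p \<in> rotations u"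
    by (rule ex_key_word_rotation)
  \<comment> \<open>Moving the zeros to the end puts the changed letter first, the form in which
    \<open>key_words_decrement_less\<close> applies.\<close>
  have "Suc a # w @ replicate l 0 \<in> rotations ?v"
    using append_swap_in_rotations[of "Suc a # w" "replicate l 0"] by (simp add: v)
  moreover have "u \<in> rotations (a # w @ replicate l 0)"
    using u(2) rotations_eq[OF append_swap_in_rotations[of "a # w" "replicate l 0"]] by simp
  ultimately have "rev u < rev ?v"
    by (rule key_words_decrement_less[OF vK])
  then obtain i where i: "i < Suc m" "u = key n k i"
    using ex_key_less[OF u(1) _ m] by blast
  have "rev u \<le> rev (key n k m)"
  proof (cases "i = m")
    case False
    with i m have "rev u < rev (key n k m)"
      using key_less_key[of i m n k] by simp
    then show ?thesis by simp
  qed (simp add: i)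
  moreover have "rev ?p \<le> rev u"
    using key_words_rotation_le[OF u(1,3)] .
  ultimately have "rev w @ a # replicate l 0 \<le> rev (key n k m)"
    by (auto intro: order_trans)
  moreover have "rev (key n k m) < rev w @ Suc a # replicate l 0"
    using key_less_key[of m "Suc m" n k] m by (simp add: v)
  moreover have "length (rev (key n k m)) = length (rev w) + Suc l"
    using key_in_key_words[of m n k] m len by (auto simp: v key_words_def words_def)
  ultimately obtain y where "rev (key n k m) = rev w @ a # y" "length y = l"
    by (rule between_append_Suc)
  then have "key n k m = rev y @ a # w" "length (rev y) = l"
    by (simp_all add: rev_swap)
  then show thesis
    by (rule that)
qed

text \<open>The preceding key-word consists of \<open>l\<close> letters followed by
  \<open>a # w\<close>, so unless it is the zero word its shift by \<open>l\<close> is the join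
  word. Later shifts only see suffixes of \<open>w\<close>, which both key-words share.\<close>

lemma joined_split:
  assumes k: "1 \<le> k" and m: "Suc m < num_keys n k"
    and v: "key n k (Suc m) = replicate l 0 @ Suc a # w"
    and xs: "xs = ys @ zero_shifts n (key n k m)"
  obtains A where "xs = A @ (a # w @ replicate l 0)
    # map (\<lambda>i. drop i (key n k (Suc m)) @ replicate i 0) [Suc l..<n]"
proof -
  let ?v = "key n k (Suc m)" and ?u = "key n k m" and ?p = "a # w @ replicate l 0"
  obtain z where z: "?u = z @ a # w" "length z = l"
    using previous_key[OF m v] .
  have vK: "?v \<in> key_words n k"
    using key_in_key_words[OF m] .
  then have "length ?v = n"
    by (auto simp: key_words_def words_def)
  then have n: "n = Suc (l + length w)"
    by (simp add: v)
  show thesis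
  proof (cases "?u = replicate n 0")
    case True
    then have "a # w = replicate (Suc (length w)) 0"
      using z n by (metis append_eq_append_conv length_Cons length_replicate replicate_add add_Suc_right)
    then have aw: "a = 0" "w = replicate (length w) 0"
      by simp_all
    \<comment> \<open>A key-word with a nonzero letter cannot end in zeros, so \<open>w\<close> is
      empty. The join word is then the zero word itself, with nothing after it.\<close>
    then have "length w = 0"
      using key_words_no_trailing_0[of "replicate l 0" a "[]" "length w" n k] vK
      by (simp add: v)
    then have "w = []" "n = Suc l"
      using n by simp_all
    with True aw show thesis
      using that[of ys] xs by (simp add: zero_shifts_def)
  next
    case False
    let ?f = "\<lambda>i. drop i ?u @ replicate i 0"
    have "[0..<n] = [0..<l] @ l # [Suc l..<n]"
      using n upt_add_eq_append[of 0 l "n - l"] by (simp add: upt_conv_Cons del: upt_Suc)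
    moreover have "?f l = ?p"
      using z by simp
    moreover have "map ?f [Suc l..<n] = map (\<lambda>i. drop i ?v @ replicate i 0) [Suc l..<n]"
      using z by (auto simp: v Suc_le_eq dest!: less_imp_Suc_add)
    ultimately have "zero_shifts n ?u = map ?f [0..<l] @ ?p # map (\<lambda>i. drop i ?v @ replicate i 0) [Suc l..<n]"
      using False by (simp add: zero_shifts_def)
    then show thesis
      using that[of "ys @ map ?f [0..<l]"] xs by simp
  qed
qed

lemma joined_Suc:
  assumes k: "1 \<le> k" and m: "Suc m < num_keys n k" and inv: "joined n k m (join_upto n k m)"
  shows "joined n k (Suc m) (join_upto n k (Suc m))"
proof -
  let ?v = "key n k (Suc m)" and ?D = "join_upto n k m"
  let ?f = "\<lambda>i. drop i ?v @ replicate i 0"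
  let ?R = "\<lambda>u v :: word. tl u = butlast v"
  have vK: "?v \<in> key_words n k"
    using key_in_key_words[OF m] .
  then have len: "length ?v = n"
    by (auto simp: key_words_def words_def)
  have v0: "?v \<noteq> replicate n 0"
    using key_nonzero[OF k m] .
  then obtain l a w where v: "?v = replicate l 0 @ Suc a # w"
    using ex_lead_form[of ?v] len by auto
  have n: "n = Suc (l + length w)"
    using len by (simp add: v)
  let ?p = "a # w @ replicate l 0" and ?C = "key_cycle ?v"
  let ?B = "map ?f [Suc l..<n]"
  from inv have D: "distinct ?D" "set ?D = (\<Union>i\<le>m. rotations (key n k i))"
    "successively ?R ?D" "preceded ?D"
    by (auto simp: joined_def)
  obtain ys where "?D = ys @ zero_shifts n (key n k m)"
    using inv by (auto simp: joined_def)
  then obtain A where A: "?D = A @ ?p # ?B"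
    by (rule joined_split[OF k m v])
  \<comment> \<open>Distinctness of \<open>?D\<close> keeps \<open>?p\<close> out of
    \<open>A\<close>, so \<open>insert_after\<close> acts at exactly this occurrence.\<close>
  have D': "join_upto n k (Suc m) = A @ ?p # ?C @ ?B"
    using D(1) A insert_after_append[of ?p A ?C ?B]
    by (simp add: join_word_def lead_simps[OF v])
  obtain E where E: "?C = E @ map ?f [0..<Suc l]"
    using key_cycle_suffix[OF v] .
  have setC: "set ?C = rotations ?v"
    using set_key_cycle[OF v] .
  have "set ?C \<inter> set ?D = {}"
  proof -
    have False if "i \<le> m" "x \<in> rotations ?v" "x \<in> rotations (key n k i)" for i x
    proof -
      have "key n k i = ?v"
        using key_words_rotations_eq[OF _ vK that(3,2)] key_in_key_words[of i n k] that(1) m by simp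
      then show False
        using key_less_key[of i "Suc m" n k] that(1) m by simp
    qed
    then show ?thesis
      unfolding setC D(2) by blast
  qed
  then have "distinct (A @ ?p # ?C @ ?B)"
    using D(1) distinct_key_cycle[OF v] unfolding A by auto
  moreover have "set (A @ ?p # ?C @ ?B) = (\<Union>i\<le>Suc m. rotations (key n k i))"
    using D(2) setC unfolding A by (auto simp: atMost_Suc)
  \<comment> \<open>The first word of \<open>?C\<close> can follow \<open>?p\<close>, and the last
    word of \<open>?C\<close> has the same tail as \<open>?p\<close>, so whatever could follow
    \<open>?p\<close> can follow \<open>?C\<close>.\<close>
  moreover have "successively ?R (A @ ?p # ?C @ ?B)"
  proof -
    have last: "last ?C = Suc a # w @ replicate l 0"
      unfolding E by (simp add: v)
    have hd: "butlast (hd ?C) = w @ replicate l 0"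
    proof -
      have "hd ?C = w @ replicate l 0 @ [Suc a]"
        using card_rotations_pos[of ?v]
        by (simp add: key_cycle_def lead_simps[OF v] hd_map upt_conv_Cons)
      then show ?thesis
        by (simp add: butlast_append)
    qed
    have C: "successively ?R ?C" "?C \<noteq> []"
      using successively_rotate card_rotations_pos[of ?v]
      by (simp_all add: key_cycle_conv[OF v] del: rotate_Suc)
    have "successively ?R (A @ [?p])" "successively ?R ?B" "?B = [] \<or> tl ?p = butlast (hd ?B)"
      using D(3) unfolding A by (auto simp: successively_append_iff successively_Cons)
    then have "successively ?R ((A @ [?p]) @ ?C @ ?B)"
      using C hd last unfolding successively_append_iff by auto
    then show ?thesis
      by simp
  qed
  moreover have "preceded (A @ ?p # ?C @ ?B)"
  proof -
    have "b # x \<in> set (A @ [?p])" if bx: "Suc b # x \<in> set ?C" for b x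
    proof -
      have rot: "Suc b # x \<in> rotations ?v"
        using bx setC by simp
      then have "Suc b # x \<in> words n k"
        using rotations_subset_words vK key_words_subset by blast
      then have "b # x \<in> words n k"
        by (auto simp: words_def)
      then obtain u where u: "u \<in> key_words n k" "u \<in> rotations (b # x)" "b # x \<in> rotations u"
        by (rule ex_key_word_rotation)
      then obtain i where "i < Suc m" "u = key n k i"
        using key_words_decrement_less[OF vK rot] ex_key_less[OF _ _ m] by metis
      with u have "b # x \<in> set ?D"
        unfolding D(2) by (auto simp: less_Suc_eq_le)
      \<comment> \<open>Such a word is \<open>b # s @ replicate i 0\<close> with
        \<open>b # s\<close> a suffix of the key-word, and \<open>key_words_suffix_increment\<close>
        forbids its increment among the rotations.\<close>
      moreover have "b # x \<notin> set ?B"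
      proof
        assume "b # x \<in> set ?B"
        then obtain i where i: "Suc l \<le> i" "i < n" "b # x = drop i ?v @ replicate i 0"
          by auto
        then obtain s where s: "drop i ?v = b # s" "x = s @ replicate i 0"
          using len by (cases "drop i ?v") auto
        have "?v = take i ?v @ b # s" "length (take i ?v) = i"
          using append_take_drop_id[of i ?v] i len by (simp_all add: s)
        then show False
          using key_words_suffix_increment[of "take i ?v" b s n k] vK rot s by simp
      qed
      ultimately show ?thesis
        unfolding A by auto
    qed
    then have "preceded ((A @ [?p]) @ ?C @ ?B)"
      using preceded_insert[of "A @ [?p]" ?B ?C] D(4) unfolding A by simp
    then show ?thesis
      by simp
  qed
  \<comment> \<open>The shifts by \<open>0\<close> to \<open>l\<close> close \<open>?C\<close>, and
    \<open>?B\<close> supplies the remaining ones.\<close>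
  moreover have "A @ ?p # ?C @ ?B = (A @ ?p # E) @ zero_shifts n ?v"
  proof -
    have "[0..<n] = [0..<Suc l] @ [Suc l..<n]"
      using n upt_add_eq_append[of 0 "Suc l" "length w"] by simp
    then show ?thesis
      using v0 by (simp add: zero_shifts_def E del: upt_Suc)
  qed
  ultimately show ?thesis
    unfolding joined_def D' by blast
qed

lemma joined_join_upto:
  assumes "1 \<le> k" "m < num_keys n k"
  shows "joined n k m (join_upto n k m)"
  using assms(2) by (induction m) (use assms joined_0 joined_Suc in \<open>auto simp del: join_upto.simps\<close>)

section \<open>Properties of the full joined sequence\<close>

lemma cycle_joining_props:
  assumes "1 \<le> n" "1 \<le> k"
  shows "distinct (cycle_joining n k)" "set (cycle_joining n k) = words n k"
    "successively (\<lambda>u v. tl u = butlast v) (cycle_joining n k)" "preceded (cycle_joining n k)"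
    "cycle_joining n k \<noteq> []" "last (cycle_joining n k) = (k - 1) # replicate (n - 1) 0"
proof -
  let ?M = "num_keys n k - 1"
  have pos: "0 < num_keys n k"
    using num_keys_pos assms by simp
  then have inv: "joined n k ?M (cycle_joining n k)"
    unfolding cycle_joining_def using joined_join_upto[of k ?M n] assms by simp
  then show "distinct (cycle_joining n k)" "preceded (cycle_joining n k)"
    "successively (\<lambda>u v. tl u = butlast v) (cycle_joining n k)"
    by (auto simp: joined_def)
  have "(\<Union>i\<le>?M. rotations (key n k i)) = words n k"
  proof (intro equalityI subsetI)
    fix x
    assume "x \<in> (\<Union>i\<le>?M. rotations (key n k i))"
    then obtain i where "i < num_keys n k" "x \<in> rotations (key n k i)"
      using pos by (metis Suc_pred' UN_E atMost_iff less_Suc_eq_le)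
    then show "x \<in> words n k"
      using key_in_key_words key_words_subset rotations_subset_words by blast
  next
    fix x
    assume "x \<in> words n k"
    then obtain u where "u \<in> key_words n k" "x \<in> rotations u"
      by (rule ex_key_word_rotation)
    moreover from this obtain i where "i < num_keys n k" "u = key n k i"
      using ex_key by metis
    ultimately show "x \<in> (\<Union>i\<le>?M. rotations (key n k i))"
      by auto
  qed
  with inv show "set (cycle_joining n k) = words n k"
    by (simp add: joined_def)
  \<comment> \<open>The greatest key-word is constant, and its last shift keeps a single letter
    \<open>k - 1\<close> before zeros. For \<open>k = 1\<close> the only entry, the zero word, has
    the same form.\<close>
  obtain ys where ys: "cycle_joining n k = ys @ zero_shifts n (replicate n (k - 1))"
    using inv last_key assms by (auto simp: joined_def)
  have "zero_shifts n (replicate n (k - 1)) \<noteq> []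
    \<and> last (zero_shifts n (replicate n (k - 1))) = (k - 1) # replicate (n - 1) 0"
  proof -
    have "drop j (replicate (Suc j) c) = [c]" for j and c :: nat
      unfolding drop_replicate by simp
    from this[simplified] show ?thesis
      using assms by (cases n) (auto simp: zero_shifts_def)
  qed
  with ys show "cycle_joining n k \<noteq> []"
    "last (cycle_joining n k) = (k - 1) # replicate (n - 1) 0"
    by simp_all
qed

section \<open>The greedy algorithm\<close>

text \<open>Descend one letter at a time: each word found splits the prefix, so the next one lies
  even earlier.\<close>

lemma preceded_smaller:
  assumes "preceded xs" "xs = ys @ (a # x) # zs" "b < a"
  shows "b # x \<in> set ys"
  using assms(2,3)
proof (induction a arbitrary: ys zs)
  case (Suc a)
  then have a: "a # x \<in> set ys"
    using assms(1) by (auto simp: preceded_def)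
  show ?case
  proof (cases "b = a")
    case False
    obtain us vs where us: "ys = us @ (a # x) # vs"
      using a by (meson split_list)
    with Suc have "b # x \<in> set us"
      using Suc.IH[of us "vs @ (Suc a # x) # zs"] False by simp
    with us show ?thesis
      by simp
  qed (use a in simp)
qed simp

text \<open>Induction on the part \<open>t\<close> still to be produced: each unfolding appends the
  next entry of \<open>W\<close>, and the lack of symbols stops the recursion at
  \<open>W\<close>.\<close>

lemma greedy_max_prefix:
  assumes "\<And>h v t. h \<noteq> [] \<Longrightarrow> h @ v # t = W \<Longrightarrow>
      next_symbols k h \<noteq> {} \<and> v = tl (last h) @ [Max (next_symbols k h)]"
    and "next_symbols k W = {}"
    and "h @ t = W" "h \<noteq> []"
  shows "greedy_max k h = W"
  using assms(3,4)
proof (induction t arbitrary: h)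
  case Nil
  then have h: "h = W"
    by simp
  show ?case
    unfolding h by (subst greedy_max.simps) (simp add: assms(2))
next
  case (Cons v t)
  from assms(1)[of h v t] Cons have "greedy_max k h = greedy_max k (h @ [v])"
    by (simp add: greedy_max.simps[of k h])
  with Cons.IH[of "h @ [v]"] Cons.prems show ?case
    by simp
qed

theorem theorem4:
  fixes n k :: nat
  assumes "n \<ge> 1" and "k \<ge> 1"
  shows "cycle_joining n k = prefer_max_rev n k"
proof -
  let ?D = "cycle_joining n k"
  let ?W = "map rev (rev ?D)"
  note D = cycle_joining_props[OF assms]
  have "greedy_max k [replicate (n - 1) 0 @ [k - 1]] = ?W"
  proof (rule greedy_max_prefix)
    have "?W = rev (last ?D) # tl ?W"
      using D(5) by (cases ?D rule: rev_cases) auto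
    then show "[replicate (n - 1) 0 @ [k - 1]] @ tl ?W = ?W"
      using D(6) by simp
  next
    have W: "set ?W = words n k"
    proof -
      have "rev ` words n k = words n k"
        by (force simp: words_def intro: rev_image_eqI[where x = "rev _"])
      then show ?thesis
        using D(2) by simp
    qed
    have lastW: "last ?W \<in> words n k"
      using W D(5) last_in_set[of ?W] by simp
    \<comment> \<open>Every candidate successor is a word over the alphabet, and \<open>?W\<close>
      already contains all of these.\<close>
    then have "tl (last ?W) @ [a] \<in> words n k" if "a < k" for a
      using that assms(1) by (cases "last ?W") (auto simp: words_def)
    then show "next_symbols k ?W = {}"
      using W by (auto simp: next_symbols_def)
  next
    fix h v t
    assume "h \<noteq> []" and eq: "h @ v # t = ?W"
    have Deq: "?D = map rev (rev t) @ rev v # map rev (rev h)"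
    proof -
      have "?D = map rev (rev ?W)"
        by (simp add: rev_map)
      then show ?thesis
        by (simp flip: eq)
    qed
    have "rev v \<in> words n k"
      unfolding D(2)[symmetric] Deq by simp
    then obtain a x where v: "rev v = a # x" "a < k"
      using assms(1) by (cases "rev v") (auto simp: words_def)
    \<comment> \<open>In \<open>?D\<close> the entry right after \<open>rev v\<close> is
      \<open>rev (last h)\<close>; reversing their overlap gives the greedy successor rule.\<close>
    have "tl (rev v) = butlast (rev (last h))"
      using D(3) \<open>h \<noteq> []\<close> unfolding Deq
      by (auto simp: successively_append_iff successively_Cons hd_map hd_rev)
    then have "rev x = tl (last h)"
      by (metis butlast_rev list.sel(3) rev_rev_ident v(1))
    then have va: "v = tl (last h) @ [a]"
      using v by (simp add: rev_swap)
    have "v \<notin> set h"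
      using D(1) unfolding Deq by auto
    then have a: "a \<in> next_symbols k h"
      using v va by (simp add: next_symbols_def)
    have "b \<le> a" if b: "b \<in> next_symbols k h" for b
    proof (rule ccontr)
      assume "\<not> b \<le> a"
      let ?u = "b # x"
      have "b < k" and nin: "rev ?u \<notin> set h"
        using b \<open>rev x = tl (last h)\<close> by (auto simp: next_symbols_def)
      then have "?u \<in> set ?D"
        using \<open>rev v \<in> words n k\<close> v unfolding D(2) by (auto simp: words_def)
      moreover have "?u \<notin> set (map rev (rev h))"
        using nin by (metis imageE rev_rev_ident set_map set_rev)
      ultimately have "?u \<in> set (map rev (rev t))"
        using \<open>\<not> b \<le> a\<close> v unfolding Deq by auto
      then obtain ys zs where yz: "map rev (rev t) = ys @ ?u # zs"
        by (meson split_list)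
      then have "a # x \<in> set ys"
        using preceded_smaller[OF D(4), of ys b x "zs @ rev v # map rev (rev h)" a] \<open>\<not> b \<le> a\<close>
        by (simp add: Deq)
      then show False
        using D(1) v yz unfolding Deq by auto
    qed
    then have "Max (next_symbols k h) = a"
      using a by (intro Max_eqI) (auto simp: next_symbols_def)
    then show "next_symbols k h \<noteq> {} \<and> v = tl (last h) @ [Max (next_symbols k h)]"
      using a va by auto
  qed simp
  then show ?thesis
    by (simp add: prefer_max_rev_def prefer_max_def rev_map)
qed

end
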